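(* Let $n\ge1$ and $0<\alpha<1$. There exist a bounded sequence of real numbers $\{v_j\}_{j\in\mathbb Z}$, a $\rho$-lacunary sequence $\{a_j\}_{j\in\mathbb Z}$ of positive real numbers (for some $\rho>1$) and a function $f\in L^\infty(\mathbb R^{n+1})$ such that $T^*f(x,t)=\infty$ for all $(x,t)\in\mathbb R^{n+1}$.
   Context: For $0<\alpha<1$ and $\tau>0$, the fractional Poisson operator generated by the parabolic operator $L=\partial_t-\Delta$ on $\mathbb R^{n+1}=\mathbb R^n\times\mathbb R$ is $$\mathcal P_\tau^\alpha f(x,t)=\frac{\tau^{2\alpha}}{4^\alpha\Gamma(\alpha)}\int_0^\infty\int_{\mathbb R^n}\frac{e^{-(\tau^2+|y|^2)/(4s)}}{(4\pi s)^{n/2}}f(x-y,t-s)\,dy\,\frac{ds}{s^{1+\alpha}}.$$ A sequence $\{a_j\}_{j\in\mathbb Z}$ of positive real numbers is $\rho$-lacunary ($\rho>1$) if $a_{j+1}/a_j\ge\rho$ for all $j\in\mathbb Z$. For $N=(N_1,N_2)\in\mathbb Z^2$ with $N_1<N_2$, $$T_N^\alpha f(x,t)=\sum_{j=N_1}^{N_2}v_j\big(\mathcal P_{a_{j+1}}^\alpha f(x,t)-\mathcal P_{a_j}^\alpha f(x,t)\big),$$ and $T^*f(x,t)=\sup_N|T_N^\alpha f(x,t)|$, the supremum being over all $N=(N_1,N_2)\in\mathbb Z^2$ with $N_1<N_2$. *)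

theory Defs
  imports "HOL-Analysis.Analysis"
begin

text \<open>
  Points of \<open>\<real>\<^sup>n\<^sup>+\<^sup>1 = \<real>\<^sup>n \<times> \<real>\<close> are pairs \<open>(x, t)\<close> of type \<open>(real ^ 'n) \<times> real\<close> with \<open>n = CARD('n)\<close>.
  All integrals are Lebesgue integrals. For \<open>f\<close> in \<open>Linfty\<close> (below) and \<open>\<tau> > 0\<close> the iterated integral in
  \<open>frac_poisson\<close> converges absolutely at every point, so the convention that non-integrable functions
  have integral \<open>0\<close> plays no role there.
\<close>

definition frac_poisson ::
    "real \<Rightarrow> real \<Rightarrow> ((real ^ 'n) \<times> real \<Rightarrow> real) \<Rightarrow> (real ^ 'n) \<times> real \<Rightarrow> real" where
  "frac_poisson \<alpha> \<tau> f = (\<lambda>(x, t).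
     \<tau> powr (2 * \<alpha>) / (4 powr \<alpha> * Gamma \<alpha>) *
     (LINT s:{0<..}|lebesgue.
        (LINT y|lebesgue.
           exp (- (\<tau>\<^sup>2 + (norm y)\<^sup>2) / (4 * s)) / (4 * pi * s) powr (real CARD('n) / 2)
             * f (x - y, t - s)) / s powr (1 + \<alpha>)))"

definition lacunary :: "real \<Rightarrow> (int \<Rightarrow> real) \<Rightarrow> bool" where
  "lacunary \<rho> a \<longleftrightarrow> \<rho> > 1 \<and> (\<forall>j. a j > 0) \<and> (\<forall>j. a (j + 1) / a j \<ge> \<rho>)"

definition diff_transform ::
    "real \<Rightarrow> (int \<Rightarrow> real) \<Rightarrow> (int \<Rightarrow> real) \<Rightarrow> int \<times> int
      \<Rightarrow> ((real ^ 'n) \<times> real \<Rightarrow> real) \<Rightarrow> (real ^ 'n) \<times> real \<Rightarrow> real" where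
  "diff_transform \<alpha> v a N f z =
     (\<Sum>j = fst N..snd N. v j * (frac_poisson \<alpha> (a (j + 1)) f z - frac_poisson \<alpha> (a j) f z))"

definition max_diff_transform ::
    "real \<Rightarrow> (int \<Rightarrow> real) \<Rightarrow> (int \<Rightarrow> real)
      \<Rightarrow> ((real ^ 'n) \<times> real \<Rightarrow> real) \<Rightarrow> (real ^ 'n) \<times> real \<Rightarrow> ereal" where
  "max_diff_transform \<alpha> v a f z =
     (SUP N \<in> {(N1, N2). N1 < N2}. ereal \<bar>diff_transform \<alpha> v a N f z\<bar>)"

text \<open>Representatives of elements of \<open>L\<^sup>\<infinity>\<close>: Lebesgue measurable and essentially bounded.\<close>

definition Linfty :: "('a::euclidean_space \<Rightarrow> real) set" where
  "Linfty = {f. f \<in> borel_measurable lebesgue \<and> (\<exists>C. AE z in lebesgue. \<bar>f z\<bar> \<le> C)}"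

end

theory Submission
  imports Defs "HOL-Probability.Distributions"
begin

text \<open>
  For a function \<open>g\<close> of time only the heat kernel integrates out, and the substitution \<open>s = \<tau>\<^sup>2 r\<close> turns
  \<open>\<P>\<^sub>\<tau> g(t)\<close> into a constant times \<open>\<integral> k(r) g(t - \<tau>\<^sup>2 r) dr\<close> with a fixed positive integrable \<open>k\<close>. Take
  \<open>g(t) = cos (\<omega> ln \<bar>t\<bar>)\<close> and \<open>a\<^sub>j = exp (\<pi> j / (2 \<omega>))\<close>: since \<open>\<omega> ln a\<^sub>j\<^sup>2 = \<pi> j\<close>, the number
  \<open>(-1)\<^sup>j g(t - a\<^sub>j\<^sup>2 r)\<close> equals \<open>cos (\<omega> ln \<bar>r - t / a\<^sub>j\<^sup>2\<bar>)\<close>, so \<open>(-1)\<^sup>j \<P>\<^sub>a\<^sub>j g(t)\<close> converges, for every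
  \<open>t\<close>, to a multiple of \<open>\<integral> k(r) cos (\<omega> ln r) dr\<close>, which is positive for small \<open>\<omega>\<close>. With alternating signs
  \<open>v\<^sub>j = (-1)\<^sup>j\<^sup>+\<^sup>1\<close> the terms of \<open>T\<^sub>N\<close> are then bounded below by a positive constant for all large \<open>j\<close>.
\<close>

section \<open>Total mass of the heat kernel\<close>

text \<open>The Gaussian factors over the coordinates into centred normal densities of variance
  \<open>2 * s\<close>, each of integral one.\<close>

lemma heat_kernel_lborel_integral:
  fixes s :: real
  assumes s: "s > 0"
  shows "(LINT y|lborel. exp (- (norm (y :: 'a :: euclidean_space))\<^sup>2 / (4 * s))
           / (4 * pi * s) powr (real DIM('a) / 2)) = 1"
proof -
  interpret product_sigma_finite "\<lambda>_::'a. lborel :: real measure" ..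
  define \<phi> where "\<phi> = normal_density 0 (sqrt (2 * s))"
  have prod: "exp (- (norm y)\<^sup>2 / (4 * s)) / (4 * pi * s) powr (real DIM('a) / 2)
      = (\<Prod>b\<in>Basis. \<phi> (y \<bullet> b))" for y :: 'a
  proof -
    have "(norm y)\<^sup>2 = (\<Sum>b\<in>Basis. (y \<bullet> b)\<^sup>2)"
      unfolding power2_norm_eq_inner by (subst euclidean_inner) (simp add: power2_eq_square)
    then have "exp (- (norm y)\<^sup>2 / (4 * s)) = (\<Prod>b\<in>Basis. exp (- (y \<bullet> b)\<^sup>2 / (4 * s)))"
      by (simp add: exp_sum[symmetric] sum_negf sum_divide_distrib)
    moreover have "(4 * pi * s) powr (real DIM('a) / 2) = sqrt (4 * pi * s) ^ DIM('a)"
      using s by (simp add: powr_half_sqrt[symmetric] powr_powr powr_realpow[symmetric])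
    ultimately show ?thesis
      using s by (simp add: \<phi>_def normal_density_def prod_dividef mult_ac)
  qed
  have "(LINT y|lborel. (\<Prod>b\<in>Basis. \<phi> ((y::'a) \<bullet> b)))
      = (LINT h|(\<Pi>\<^sub>M b\<in>Basis. lborel). (\<Prod>b\<in>Basis. \<phi> ((\<Sum>b\<in>Basis. h b *\<^sub>R b) \<bullet> (b::'a))))"
    \<comment> \<open>\<open>lborel\<close> is the image of the product measure under the map from
      coordinates to vectors, so the integral can be taken over coordinate functions.\<close>
    by (subst lborel_eq, subst integral_distr) (simp_all add: \<phi>_def)
  also have "\<dots> = (LINT h|(\<Pi>\<^sub>M b\<in>Basis. lborel). (\<Prod>b\<in>Basis. \<phi> (h (b::'a))))"
    by (intro Bochner_Integration.integral_cong refl prod.cong)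
      (simp add: inner_sum_left inner_Basis if_distrib sum.delta cong: if_cong)
  also have "\<dots> = (\<Prod>b\<in>(Basis::'a set). integral\<^sup>L lborel \<phi>)"
    by (rule product_integral_prod) (use s in \<open>auto simp: \<phi>_def\<close>)
  also have "\<dots> = 1"
    using s by (simp add: \<phi>_def)
  finally show ?thesis
    unfolding prod .
qed

section \<open>The rescaled time kernel: integrability and positivity\<close>

text \<open>The time kernel of \<open>frac_poisson\<close> in the variable \<open>r = s / \<tau>\<^sup>2\<close>, without the factor \<open>1 / (4 powr \<alpha> * Gamma \<alpha>)\<close>.\<close>

definition stable_profile :: "real \<Rightarrow> real \<Rightarrow> real" where
  "stable_profile \<alpha> r = indicator {0<..} r * (exp (- 1 / (4 * r)) / r powr (1 + \<alpha>))"

lemma borel_measurable_stable_profile [measurable]: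
  "stable_profile \<alpha> \<in> borel_measurable borel"
  unfolding stable_profile_def [abs_def] by measurable

lemma stable_profile_nonneg: "0 \<le> stable_profile \<alpha> r"
  by (simp add: stable_profile_def)

text \<open>The exponential beats the singular power: \<open>exp (- x) \<le> 2 / x\<^sup>2\<close>
  at \<open>x = 1 / (4 * r)\<close> gives \<open>32 * r\<^sup>2\<close>, and \<alpha> < 1 makes
  \<open>r\<^sup>2\<close> at most the denominator on (0, 1].\<close>

lemma stable_profile_near_zero_le:
  fixes r :: real
  assumes "\<alpha> < 1" "0 < r" "r \<le> 1"
  shows "exp (- 1 / (4 * r)) / r powr (1 + \<alpha>) \<le> 32"
proof -
  define x where "x = 1 / (4 * r)"
  have x: "x > 0" using assms by (simp add: x_def)
  have "x\<^sup>2 / 2 \<le> exp x"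
    using exp_lower_Taylor_quadratic[of x] x by simp
  then have "exp (- x) \<le> 2 / x\<^sup>2"
    using x by (simp add: exp_minus field_simps)
  also have "\<dots> = 32 * r\<^sup>2"
    using assms by (simp add: x_def power2_eq_square field_simps)
  finally have 1: "exp (- 1 / (4 * r)) \<le> 32 * r\<^sup>2" by (simp add: x_def)
  have "r\<^sup>2 = r powr 2" using assms by simp
  also have "\<dots> \<le> r powr (1 + \<alpha>)"
    using assms by (intro powr_mono') auto
  finally show ?thesis
    using 1 assms by (simp add: divide_le_eq)
qed

text \<open>The majorant is the constant 32 on [0, 1] and the pure power on [1, \<infinity>), whose
  integral converges because \<alpha> > 0.\<close>

lemma integrable_stable_profile:
  assumes "0 < \<alpha>" "\<alpha> < 1"
  shows "integrable lborel (stable_profile \<alpha>)"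
proof -
  have "(\<lambda>x::real. x powr (- 1 - \<alpha>)) integrable_on {1..}"
    using has_integral_powr_to_inf[of "- 1 - \<alpha>" 1] assms by (auto simp: integrable_on_def)
  then have "(\<lambda>x::real. x powr (- 1 - \<alpha>)) absolutely_integrable_on {1..}"
    by (intro nonnegative_absolutely_integrable_1) auto
  then have 1: "integrable lborel (\<lambda>x::real. indicator {1..} x * x powr (- 1 - \<alpha>))"
    by (simp add: set_integrable_def integrable_completion)
  have "integrable lborel (\<lambda>x::real. indicator {0..1} x * 32 + indicator {1..} x * x powr (- 1 - \<alpha>))"
    by (intro Bochner_Integration.integrable_add 1) auto
  then show ?thesis
  proof (rule Bochner_Integration.integrable_bound)
    show "AE x in lborel. norm (stable_profile \<alpha> x)
        \<le> norm (indicator {0..1} x * 32 + indicator {1..} x * x powr (- 1 - \<alpha>))"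
    proof (intro AE_I2)
      fix x :: real
      have "exp (- 1 / (4 * x)) / x powr (1 + \<alpha>) \<le> x powr (- 1 - \<alpha>)" if "x \<ge> 1"
      proof -
        have "exp (- 1 / (4 * x)) / x powr (1 + \<alpha>) \<le> 1 / x powr (1 + \<alpha>)"
          using that by (intro divide_right_mono) auto
        also have "\<dots> = x powr (- 1 - \<alpha>)"
          by (simp add: powr_minus_divide[symmetric])
        finally show ?thesis .
      qed
      then show "norm (stable_profile \<alpha> x)
        \<le> norm (indicator {0..1} x * 32 + indicator {1..} x * x powr (- 1 - \<alpha>))"
        using stable_profile_near_zero_le[of \<alpha> x] assms
        by (auto simp: stable_profile_def indicator_def)
    qed
  qed auto
qed

lemma integral_stable_profile_pos:
  assumes "0 < \<alpha>" "\<alpha> < 1"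
  shows "integral\<^sup>L lborel (stable_profile \<alpha>) > 0"
proof -
  have "integral\<^sup>L lborel (stable_profile \<alpha>) \<noteq> 0"
  proof
    assume "integral\<^sup>L lborel (stable_profile \<alpha>) = 0"
    then have "AE x in lborel. stable_profile \<alpha> x = 0"
      using integral_nonneg_eq_0_iff_AE[OF integrable_stable_profile[OF assms]]
      by (simp add: stable_profile_nonneg)
    \<comment> \<open>The profile is strictly positive on [1, 2], so vanishing almost everywhere
      would make this interval a null set.\<close>
    then have "AE x in lborel. (x::real) \<notin> {1..2}"
      by eventually_elim (auto simp: stable_profile_def)
    then have "emeasure lborel {1..2::real} = 0"
      by (subst (asm) AE_iff_measurable[of "{1..2}"]) auto
    then show False by simp
  qed
  moreover have "integral\<^sup>L lborel (stable_profile \<alpha>) \<ge> 0"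
    by (simp add: stable_profile_nonneg)
  ultimately show ?thesis by linarith
qed

text \<open>As \<omega> tends to 0 the cosine tends to 1 pointwise, so by dominated convergence the
  integrals tend to the positive total mass of the profile.\<close>

lemma exists_frequency_profile_integral_pos:
  assumes "0 < \<alpha>" "\<alpha> < 1"
  shows "\<exists>\<omega>>0. (LINT r|lborel. stable_profile \<alpha> r * cos (\<omega> * ln \<bar>r\<bar>)) > 0"
proof -
  define \<omega> where "\<omega> k = 1 / real (Suc k)" for k
  have \<omega>: "\<omega> \<longlonglongrightarrow> 0"
    unfolding \<omega>_def using LIMSEQ_inverse_real_of_nat by (simp add: inverse_eq_divide)
  have "(\<lambda>k. LINT r|lborel. stable_profile \<alpha> r * cos (\<omega> k * ln \<bar>r\<bar>))
      \<longlonglongrightarrow> (LINT r|lborel. stable_profile \<alpha> r)"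
  proof (rule integral_dominated_convergence[where w = "stable_profile \<alpha>"])
    show "AE r in lborel. (\<lambda>k. stable_profile \<alpha> r * cos (\<omega> k * ln \<bar>r\<bar>)) \<longlonglongrightarrow> stable_profile \<alpha> r"
      by (intro AE_I2) (auto intro!: tendsto_eq_intros \<omega>)
    show "AE r in lborel. norm (stable_profile \<alpha> r * cos (\<omega> k * ln \<bar>r\<bar>)) \<le> stable_profile \<alpha> r" for k
      by (intro AE_I2) (auto simp: abs_mult stable_profile_nonneg intro!: mult_left_le)
  qed (use integrable_stable_profile[OF assms] in auto)
  then have "\<forall>\<^sub>F k in sequentially. (LINT r|lborel. stable_profile \<alpha> r * cos (\<omega> k * ln \<bar>r\<bar>)) > 0"
    by (rule order_tendstoD) (rule integral_stable_profile_pos[OF assms])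
  then obtain k where "(LINT r|lborel. stable_profile \<alpha> r * cos (\<omega> k * ln \<bar>r\<bar>)) > 0"
    by (auto simp: eventually_sequentially)
  moreover have "\<omega> k > 0" by (simp add: \<omega>_def)
  ultimately show ?thesis by blast
qed

section \<open>Reduction to one-dimensional time averages\<close>

text \<open>After this reduction \<tau> enters only through the dilation inside \<open>g\<close>, so
  its effect on a log-periodic \<open>g\<close> is a phase shift, up to the translation by
  \<open>t\<close>.\<close>

lemma frac_poisson_time_only:
  fixes g :: "real \<Rightarrow> real" and x :: "real ^ 'n"
  assumes [measurable]: "g \<in> borel_measurable borel" and \<tau>: "\<tau> > 0"
  shows "frac_poisson \<alpha> \<tau> (\<lambda>z. g (snd z)) (x, t)
    = 1 / (4 powr \<alpha> * Gamma \<alpha>) * (LINT r|lborel. stable_profile \<alpha> r * g (t - \<tau>\<^sup>2 * r))"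
proof -
  have inner: "(LINT y|lebesgue. exp (- (\<tau>\<^sup>2 + (norm (y::real^'n))\<^sup>2) / (4 * s))
      / (4 * pi * s) powr (real CARD('n) / 2) * g (t - s)) = exp (- \<tau>\<^sup>2 / (4 * s)) * g (t - s)"
    if s: "s > 0" for s
  proof -
    have "(LINT y|lebesgue. exp (- (\<tau>\<^sup>2 + (norm (y::real^'n))\<^sup>2) / (4 * s))
      / (4 * pi * s) powr (real CARD('n) / 2) * g (t - s))
      = (LINT y|lborel. exp (- (\<tau>\<^sup>2 + (norm (y::real^'n))\<^sup>2) / (4 * s))
      / (4 * pi * s) powr (real CARD('n) / 2) * g (t - s))"
      by (rule integral_completion) measurable
    also have "\<dots> = (LINT y|lborel. exp (- \<tau>\<^sup>2 / (4 * s)) * g (t - s) * (exp (- (norm (y::real^'n))\<^sup>2 / (4 * s))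
      / (4 * pi * s) powr (real CARD('n) / 2)))"
      by (intro Bochner_Integration.integral_cong)
        (simp_all add: exp_add[symmetric] add_divide_distrib diff_divide_distrib exp_diff exp_minus field_simps)
    also have "\<dots> = exp (- \<tau>\<^sup>2 / (4 * s)) * g (t - s)"
      using heat_kernel_lborel_integral[OF s, where 'a = "real^'n"]
      by (simp only: integral_mult_right_zero DIM_cart DIM_real mult_1_right)
    finally show ?thesis .
  qed
  have "(LINT s:{0<..}|lebesgue. (LINT y|lebesgue. exp (- (\<tau>\<^sup>2 + (norm (y::real^'n))\<^sup>2) / (4 * s))
      / (4 * pi * s) powr (real CARD('n) / 2) * g (t - s)) / s powr (1 + \<alpha>))
     = (LINT s|lebesgue. indicator {0<..} s * (exp (- \<tau>\<^sup>2 / (4 * s)) / s powr (1 + \<alpha>)) * g (t - s))"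
    unfolding set_lebesgue_integral_def
  proof (intro Bochner_Integration.integral_cong refl)
    fix s
    show "indicator {0<..} s *\<^sub>R ((LINT y|lebesgue. exp (- (\<tau>\<^sup>2 + (norm (y::real^'n))\<^sup>2) / (4 * s))
        / (4 * pi * s) powr (real CARD('n) / 2) * g (t - s)) / s powr (1 + \<alpha>))
      = indicator {0<..} s * (exp (- \<tau>\<^sup>2 / (4 * s)) / s powr (1 + \<alpha>)) * g (t - s)"
    proof (cases "s > 0")
      case True
      show ?thesis unfolding inner[OF True] by simp
    qed simp
  qed
  also have "\<dots> = (LINT s|lborel. indicator {0<..} s * (exp (- \<tau>\<^sup>2 / (4 * s)) / s powr (1 + \<alpha>)) * g (t - s))"
    by (rule integral_completion) measurable
  also have "\<dots> = \<tau>\<^sup>2 * (LINT r|lborel. indicator {0<..} (\<tau>\<^sup>2 * r)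
      * (exp (- \<tau>\<^sup>2 / (4 * (\<tau>\<^sup>2 * r))) / (\<tau>\<^sup>2 * r) powr (1 + \<alpha>)) * g (t - \<tau>\<^sup>2 * r))"
    using lborel_integral_real_affine[of "\<tau>\<^sup>2"
      "\<lambda>s. indicator {0<..} s * (exp (- \<tau>\<^sup>2 / (4 * s)) / s powr (1 + \<alpha>)) * g (t - s)" 0] \<tau> by simp
  also have "\<dots> = \<tau>\<^sup>2 * (LINT r|lborel. \<tau> powr (- 2 - 2 * \<alpha>) * (stable_profile \<alpha> r * g (t - \<tau>\<^sup>2 * r)))"
  proof -
    have "(\<tau>\<^sup>2 * r) powr (1 + \<alpha>) = r powr (1 + \<alpha>) / \<tau> powr (- 2 - 2 * \<alpha>)" if "r > 0" for r
    proof -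
      have "\<tau>\<^sup>2 = \<tau> powr 2" using \<tau> by simp
      then have "(\<tau>\<^sup>2 * r) powr (1 + \<alpha>) = \<tau> powr (2 + 2 * \<alpha>) * r powr (1 + \<alpha>)"
        using \<tau> that by (simp add: powr_mult powr_powr algebra_simps del: powr_numeral)
      also have "\<tau> powr (2 + 2 * \<alpha>) = 1 / \<tau> powr (- 2 - 2 * \<alpha>)"
        by (simp add: powr_minus_divide[symmetric] add.commute)
      finally show ?thesis by simp
    qed
    then have "indicator {0<..} (\<tau>\<^sup>2 * r)
        * (exp (- \<tau>\<^sup>2 / (4 * (\<tau>\<^sup>2 * r))) / (\<tau>\<^sup>2 * r) powr (1 + \<alpha>)) * g (t - \<tau>\<^sup>2 * r)
      = \<tau> powr (- 2 - 2 * \<alpha>) * (stable_profile \<alpha> r * g (t - \<tau>\<^sup>2 * r))" for r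
      using \<tau> by (cases "r > 0") (simp_all add: stable_profile_def zero_less_mult_iff)
    then show ?thesis by simp
  qed
  \<comment> \<open>The Jacobian \<open>\<tau>\<^sup>2\<close> combines with the power from the
    denominator; what remains is the reciprocal of the factor
    \<open>\<tau> powr (2 * \<alpha>)\<close> in \<open>frac_poisson\<close>.\<close>
  also have "\<dots> = \<tau> powr (- 2 * \<alpha>) * (LINT r|lborel. stable_profile \<alpha> r * g (t - \<tau>\<^sup>2 * r))"
  proof -
    have "\<tau>\<^sup>2 * \<tau> powr (- 2 - 2 * \<alpha>) = \<tau> powr (- 2 * \<alpha>)"
      using \<tau> powr_add[of \<tau> 2 "- 2 - 2 * \<alpha>"] by simp
    then show ?thesis by simp
  qed
  finally show ?thesis
    using \<tau> by (simp add: frac_poisson_def powr_minus)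
qed

section \<open>Asymptotics for the log-periodic function\<close>

text \<open>The sign cancels the phase \<pi> k produced by the dilation. What is left is the
  translation by \<open>t / \<sigma> k\<close>, which tends to 0, and dominated convergence applies
  with the profile itself as majorant.\<close>

lemma frac_poisson_log_oscillation_tendsto:
  fixes x :: "real ^ 'n"
  assumes "0 < \<alpha>" "\<alpha> < 1" and \<omega>: "\<omega> > 0"
  shows "(\<lambda>k. (-1) ^ k * frac_poisson \<alpha> (exp (pi * real k / (2 * \<omega>))) (\<lambda>z. cos (\<omega> * ln \<bar>snd z\<bar>)) (x, t))
    \<longlonglongrightarrow> 1 / (4 powr \<alpha> * Gamma \<alpha>) * (LINT r|lborel. stable_profile \<alpha> r * cos (\<omega> * ln \<bar>r\<bar>))"
proof -
  define \<sigma> where "\<sigma> k = (exp (pi * real k / (2 * \<omega>)))\<^sup>2" for k :: nat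
  have \<sigma>_eq: "\<sigma> k = exp (pi * real k / \<omega>)" for k
    by (simp add: \<sigma>_def exp_double[symmetric])
  have \<sigma>_pos: "\<sigma> k > 0" for k by (simp add: \<sigma>_def)
  have "filterlim (\<lambda>k. pi / \<omega> * real k) at_top sequentially"
    using \<omega> by (intro filterlim_tendsto_pos_mult_at_top[OF tendsto_const] filterlim_real_sequentially) simp
  then have "filterlim \<sigma> at_top sequentially"
    unfolding \<sigma>_eq [abs_def] by (intro filterlim_compose[OF exp_at_top]) simp
  then have shift: "(\<lambda>k. r - t / \<sigma> k) \<longlonglongrightarrow> r" for r
    using tendsto_diff[OF tendsto_const[of r] real_tendsto_divide_at_top[OF tendsto_const[of t]]] by simp
  \<comment> \<open>If \<open>r = t / \<sigma> k\<close>, both logarithms are the junk value \<open>ln 0 = 0\<close> and the sign survives.\<close>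
  have rescale: "(-1) ^ k * cos (\<omega> * ln \<bar>t - \<sigma> k * r\<bar>) = cos (\<omega> * ln \<bar>r - t / \<sigma> k\<bar>)"
    if "r - t / \<sigma> k \<noteq> 0" for k r
  proof -
    have "\<bar>t - \<sigma> k * r\<bar> = \<sigma> k * \<bar>r - t / \<sigma> k\<bar>"
    proof -
      have "t - \<sigma> k * r = - (\<sigma> k * (r - t / \<sigma> k))"
        using \<sigma>_pos[of k] by (simp add: field_simps)
      then show ?thesis
        using \<sigma>_pos[of k] by (simp add: abs_mult)
    qed
    then have "\<omega> * ln \<bar>t - \<sigma> k * r\<bar> = \<omega> * ln \<bar>r - t / \<sigma> k\<bar> + pi * real k"
      using that \<omega> \<sigma>_pos[of k] by (simp add: ln_mult) (simp add: \<sigma>_eq field_simps)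
    then have "cos (\<omega> * ln \<bar>t - \<sigma> k * r\<bar>) = cos (\<omega> * ln \<bar>r - t / \<sigma> k\<bar>) * (-1) ^ k"
      by (simp add: cos_add mult.commute[of pi])
    then show ?thesis by simp
  qed
  have "(\<lambda>k. LINT r|lborel. (-1) ^ k * (stable_profile \<alpha> r * cos (\<omega> * ln \<bar>t - \<sigma> k * r\<bar>)))
    \<longlonglongrightarrow> (LINT r|lborel. stable_profile \<alpha> r * cos (\<omega> * ln \<bar>r\<bar>))"
  proof (rule integral_dominated_convergence[where w = "stable_profile \<alpha>"])
    show "AE r in lborel. (\<lambda>k. (-1) ^ k * (stable_profile \<alpha> r * cos (\<omega> * ln \<bar>t - \<sigma> k * r\<bar>)))
      \<longlonglongrightarrow> stable_profile \<alpha> r * cos (\<omega> * ln \<bar>r\<bar>)"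
    proof (intro AE_I2)
      fix r :: real
      show "(\<lambda>k. (-1) ^ k * (stable_profile \<alpha> r * cos (\<omega> * ln \<bar>t - \<sigma> k * r\<bar>)))
        \<longlonglongrightarrow> stable_profile \<alpha> r * cos (\<omega> * ln \<bar>r\<bar>)"
      \<comment> \<open>For r > 0 the shifted argument has the nonzero limit r, so it is eventually
        nonzero and the logarithm is continuous at the limit. Elsewhere the profile
        vanishes.\<close>
      proof (cases "r > 0")
        case True
        then have "\<forall>\<^sub>F k in sequentially. r - t / \<sigma> k \<noteq> 0"
          by (intro tendsto_imp_eventually_ne[OF shift]) simp
        then have "\<forall>\<^sub>F k in sequentially. stable_profile \<alpha> r * cos (\<omega> * ln \<bar>r - t / \<sigma> k\<bar>)
            = (-1) ^ k * (stable_profile \<alpha> r * cos (\<omega> * ln \<bar>t - \<sigma> k * r\<bar>))"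
          by eventually_elim (simp add: rescale[symmetric])
        moreover have "(\<lambda>k. stable_profile \<alpha> r * cos (\<omega> * ln \<bar>r - t / \<sigma> k\<bar>))
            \<longlonglongrightarrow> stable_profile \<alpha> r * cos (\<omega> * ln \<bar>r\<bar>)"
          using True by (intro tendsto_intros shift) auto
        ultimately show ?thesis by (rule Lim_transform_eventually[rotated])
      qed (simp add: stable_profile_def)
    qed
    show "AE r in lborel. norm ((-1) ^ k * (stable_profile \<alpha> r * cos (\<omega> * ln \<bar>t - \<sigma> k * r\<bar>)))
      \<le> stable_profile \<alpha> r" for k
      by (intro AE_I2) (auto simp: abs_mult stable_profile_nonneg intro!: mult_left_le)
  qed (use integrable_stable_profile[OF assms(1,2)] in auto)
  then have "(\<lambda>k. (-1) ^ k * (LINT r|lborel. stable_profile \<alpha> r * cos (\<omega> * ln \<bar>t - \<sigma> k * r\<bar>)))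
    \<longlonglongrightarrow> (LINT r|lborel. stable_profile \<alpha> r * cos (\<omega> * ln \<bar>r\<bar>))"
    by (simp only: integral_mult_right_zero)
  then have "(\<lambda>k. 1 / (4 powr \<alpha> * Gamma \<alpha>) *
      ((-1) ^ k * (LINT r|lborel. stable_profile \<alpha> r * cos (\<omega> * ln \<bar>t - \<sigma> k * r\<bar>))))
    \<longlonglongrightarrow> 1 / (4 powr \<alpha> * Gamma \<alpha>) * (LINT r|lborel. stable_profile \<alpha> r * cos (\<omega> * ln \<bar>r\<bar>))"
    by (rule tendsto_mult_left)
  moreover have "frac_poisson \<alpha> (exp (pi * real k / (2 * \<omega>))) (\<lambda>z. cos (\<omega> * ln \<bar>snd z\<bar>)) (x, t)
      = 1 / (4 powr \<alpha> * Gamma \<alpha>) *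
        (LINT r|lborel. stable_profile \<alpha> r * cos (\<omega> * ln \<bar>t - \<sigma> k * r\<bar>))" for k
    unfolding \<sigma>_def by (rule frac_poisson_time_only) simp_all
  ultimately show ?thesis
    by (simp only: mult.left_commute)
qed

section \<open>Divergence of the maximal operator\<close>

text \<open>Sums over windows starting at \<open>K\<close> grow at least linearly in the window
  length.\<close>

lemma max_diff_transform_eq_infinity:
  fixes v a :: "int \<Rightarrow> real"
  assumes "c > 0"
    and "\<And>j. j \<ge> int K \<Longrightarrow> c \<le> v j * (frac_poisson \<alpha> (a (j + 1)) f z - frac_poisson \<alpha> (a j) f z)"
  shows "max_diff_transform \<alpha> v a f z = \<infinity>"
proof (rule ereal_top)
  fix B :: real
  obtain m :: nat where m: "B / c < real m"
    using reals_Archimedean2 by blast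
  \<comment> \<open>\<open>Suc m\<close> rather than \<open>m\<close> keeps the window admissible,
    with strictly increasing endpoints, also for \<open>m = 0\<close>.\<close>
  let ?N = "(int K, int K + int (Suc m))"
  have "B \<le> real m * c"
    using m \<open>c > 0\<close> by (simp add: pos_divide_less_eq)
  also have "\<dots> \<le> real (card {fst ?N..snd ?N}) * c"
    using \<open>c > 0\<close> by (intro mult_right_mono) auto
  also have "\<dots> \<le> diff_transform \<alpha> v a ?N f z"
    unfolding diff_transform_def by (rule sum_bounded_below) (use assms(2) in simp)
  finally have "ereal B \<le> ereal \<bar>diff_transform \<alpha> v a ?N f z\<bar>"
    by simp
  also have "\<dots> \<le> max_diff_transform \<alpha> v a f z"
    unfolding max_diff_transform_def by (rule SUP_upper) simp
  finally show "ereal B \<le> max_diff_transform \<alpha> v a f z" .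
qed

theorem theorem1p4:
  fixes \<alpha> :: real
  assumes "0 < \<alpha>" and "\<alpha> < 1"
  shows "\<exists>(v :: int \<Rightarrow> real) (a :: int \<Rightarrow> real) (\<rho> :: real) (f :: (real ^ 'n) \<times> real \<Rightarrow> real).
           bounded (range v) \<and> \<rho> > 1 \<and> lacunary \<rho> a \<and> f \<in> Linfty \<and>
           (\<forall>x t. max_diff_transform \<alpha> v a f (x, t) = \<infinity>)"
proof -
  obtain \<omega> where \<omega>: "\<omega> > 0" and pos: "(LINT r|lborel. stable_profile \<alpha> r * cos (\<omega> * ln \<bar>r\<bar>)) > 0"
    using exists_frequency_profile_integral_pos[OF assms] by blast
  define c where "c = 1 / (4 powr \<alpha> * Gamma \<alpha>) * (LINT r|lborel. stable_profile \<alpha> r * cos (\<omega> * ln \<bar>r\<bar>))"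
  have c: "c > 0"
    using pos assms Gamma_real_pos[of \<alpha>] by (simp add: c_def)
  define v :: "int \<Rightarrow> real" where "v j = (if even j then -1 else 1)" for j
  define a :: "int \<Rightarrow> real" where "a j = exp (pi * real_of_int j / (2 * \<omega>))" for j
  define \<rho> where "\<rho> = exp (pi / (2 * \<omega>))"
  \<comment> \<open>At time 0 the convention \<open>ln 0 = 0\<close> gives the value 1, so the bound
    by 1 holds everywhere.\<close>
  define f :: "(real ^ 'n) \<times> real \<Rightarrow> real" where "f z = cos (\<omega> * ln \<bar>snd z\<bar>)" for z
  have "bounded (range v)"
    by (rule boundedI[of _ 1]) (auto simp: v_def)
  moreover have "\<rho> > 1"
    using \<omega> by (simp add: \<rho>_def)
  moreover have "lacunary \<rho> a"
    using \<open>\<rho> > 1\<close>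
    by (auto simp: lacunary_def a_def \<rho>_def exp_diff[symmetric] diff_divide_distrib[symmetric] algebra_simps)
  moreover have "f \<in> Linfty"
  proof -
    have "f \<in> borel_measurable borel"
      unfolding f_def [abs_def] by (simp add: borel_prod[symmetric])
    then have "f \<in> borel_measurable lebesgue"
      by (intro measurable_completion) simp
    moreover have "AE z in lebesgue. \<bar>f z\<bar> \<le> 1"
      by (simp add: f_def)
    ultimately show ?thesis
      unfolding Linfty_def by blast
  qed
  moreover have "max_diff_transform \<alpha> v a f (x, t) = \<infinity>" for x t
  proof -
    have lim: "(\<lambda>k. (-1) ^ k * frac_poisson \<alpha> (a (int k)) f (x, t)) \<longlonglongrightarrow> c"
      using frac_poisson_log_oscillation_tendsto[OF assms \<omega>, of x t] by (simp add: c_def a_def f_def [abs_def])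
    \<comment> \<open>Half the limit suffices: consecutive Poisson values have opposite signs, so
      after multiplication by \<open>v j\<close> both add positively, each contributing more than
      \<open>c / 2\<close>.\<close>
    have "\<forall>\<^sub>F k in sequentially. (-1) ^ k * frac_poisson \<alpha> (a (int k)) f (x, t) > c / 2"
      by (rule order_tendstoD(1)[OF lim]) (use c in simp)
    then obtain K where K: "\<And>k. k \<ge> K \<Longrightarrow> (-1) ^ k * frac_poisson \<alpha> (a (int k)) f (x, t) > c / 2"
      by (auto simp: eventually_sequentially)
    show ?thesis
    proof (rule max_diff_transform_eq_infinity[OF c, of K])
      fix j assume "j \<ge> int K"
      then obtain k where k: "j = int k" "k \<ge> K"
        by (metis nat_int_comparison(3) nonneg_int_cases of_nat_0_le_iff order_trans)
      show "c \<le> v j * (frac_poisson \<alpha> (a (j + 1)) f (x, t) - frac_poisson \<alpha> (a j) f (x, t))"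
        using K[of k] K[of "Suc k"] k by (cases "even k") (auto simp: v_def add.commute)
    qed
  qed
  ultimately show ?thesis by blast
qed

end
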